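(* Consider the power allocation $p(z)$ on a line network under linearized Distflow voltage-drop constraints only, as described in the context. Let $u_{ij}(p_{ij})=w_{ij}u(p_{ij})$ for $i=1,\dots,I$, $j=1,\dots,J$. If $w_{ij}=\overline R_i$, then all EVs are charged at the same rate: for every $z\in\mathbb R_+^{I\times J}$ with $z\ne0$ and all $(i,j)$ with $z_{ij}>0$, $p_{ij}(z)=p(z)>0$, where the common value does not depend on $(i,j)$ and is $$p(z)=\delta\Big(\sum_{i=1}^I\overline R_i\sum_{j=1}^Jz_{ij}\Big)^{-1}.$$
   Context: **Network.** The network is a line with nodes $0,1,\dots,I$, where $0$ is the feeder and consecutive nodes $i-1,i$ are joined by an edge of resistance $R_{i-1,i}>0$. Put $\overline R_i=\sum_{k=1}^iR_{k-1,k}$ (total resistance of the path from node $i$ to the feeder). EV types are $j=1,\dots,J$, and $z=(z_{ij})\in\mathbb R_+^{I\times J}$ collects the numbers of uncharged type-$j$ EVs at nodes $i=1,\dots,I$ (real values allowed). **Utility.** $u$ is strictly increasing and strictly concave on $\mathbb R_+$ and twice differentiable on $(0,\infty)$, with $\lim_{x\to0}u'(x)=\infty$ (the value $-\infty$ at $0$ is allowed). **Allocation.** $p(z)=(p_{ij}(z))$ maximizes $\sum_{i=1}^I\sum_{j=1}^Jz_{ij}u_{ij}(p_{ij})$ over $p\ge0$ subject only to the voltage-drop constraints $W^{lin}_{kk}\ge\underline\upsilon$, $k=1,\dots,I$, where $$W^{lin}_{kk}=W_{00}-2\sum_{l=1}^kR_{l-1,l}\sum_{m=l}^I\sum_{j=1}^Jz_{mj}p_{mj}$$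 and $W_{00}>\underline\upsilon>0$ are given constants. By convention $p_{ij}(z)=0$ if $z_{ij}=0$. (There are no load constraints, i.e. no limits on node power or on individual charging rates.) **Constant.** $\delta=\dfrac{W_{00}-\underline\upsilon}{2}$. *)

theory Defs
  imports "HOL-Analysis.Analysis"
begin

text \<open>
  Nodes are \<open>0, 1, \<dots>, I\<close> with feeder \<open>0\<close>, and \<open>R (i - 1) i\<close> is the resistance of the edge
  joining \<open>i - 1\<close> and \<open>i\<close>.  Families indexed by node and type are functions
  \<open>nat \<Rightarrow> nat \<Rightarrow> real\<close> of which only the entries in \<open>{1..I} \<times> {1..J}\<close> matter.
\<close>

definition path_resistance :: "(nat \<Rightarrow> nat \<Rightarrow> real) \<Rightarrow> nat \<Rightarrow> real" where
  "path_resistance R i = (\<Sum>k=1..i. R (k - 1) k)"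

text \<open>
  Utilities are \<open>ereal\<close>-valued because \<open>u 0 = -\<infinity>\<close> is allowed.  Strict monotonicity on
  \<open>{0..}\<close> already forces \<open>u x\<close> to be finite for \<open>x > 0\<close> and excludes \<open>u 0 = \<infinity>\<close>, so that no
  sum below mixes the two infinities and \<open>real_of_ereal\<close> loses nothing on \<open>{0<..}\<close>.
\<close>

definition strictly_concave_on :: "real set \<Rightarrow> (real \<Rightarrow> ereal) \<Rightarrow> bool" where
  "strictly_concave_on S u \<longleftrightarrow> convex S \<and>
     (\<forall>x\<in>S. \<forall>y\<in>S. \<forall>t. x \<noteq> y \<longrightarrow> 0 < t \<longrightarrow> t < 1 \<longrightarrow>
        ereal (1 - t) * u x + ereal t * u y < u ((1 - t) * x + t * y))"

definition utility :: "(real \<Rightarrow> ereal) \<Rightarrow> bool" where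
  "utility u \<longleftrightarrow>
     strict_mono_on {0..} u \<and>
     strictly_concave_on {0..} u \<and>
     (\<forall>x>0. (\<lambda>t. real_of_ereal (u t)) differentiable (at x)) \<and>
     (\<forall>x>0. deriv (\<lambda>t. real_of_ereal (u t)) differentiable (at x)) \<and>
     filterlim (deriv (\<lambda>t. real_of_ereal (u t))) at_top (at_right 0)"

definition W_lin ::
  "nat \<Rightarrow> nat \<Rightarrow> (nat \<Rightarrow> nat \<Rightarrow> real) \<Rightarrow> real \<Rightarrow> (nat \<Rightarrow> nat \<Rightarrow> real) \<Rightarrow> (nat \<Rightarrow> nat \<Rightarrow> real) \<Rightarrow> nat \<Rightarrow> real"
where
  "W_lin I J R W00 z p k =
     W00 - 2 * (\<Sum>l=1..k. R (l - 1) l * (\<Sum>m=l..I. \<Sum>j=1..J. z m j * p m j))"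

definition feasible ::
  "nat \<Rightarrow> nat \<Rightarrow> (nat \<Rightarrow> nat \<Rightarrow> real) \<Rightarrow> real \<Rightarrow> real \<Rightarrow> (nat \<Rightarrow> nat \<Rightarrow> real) \<Rightarrow> (nat \<Rightarrow> nat \<Rightarrow> real) \<Rightarrow> bool"
where
  "feasible I J R W00 \<upsilon> z p \<longleftrightarrow>
     (\<forall>i\<in>{1..I}. \<forall>j\<in>{1..J}. p i j \<ge> 0) \<and>
     (\<forall>k\<in>{1..I}. W_lin I J R W00 z p k \<ge> \<upsilon>)"

definition total_utility ::
  "nat \<Rightarrow> nat \<Rightarrow> (nat \<Rightarrow> nat \<Rightarrow> real \<Rightarrow> ereal) \<Rightarrow> (nat \<Rightarrow> nat \<Rightarrow> real) \<Rightarrow> (nat \<Rightarrow> nat \<Rightarrow> real) \<Rightarrow> ereal"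
where
  "total_utility I J U z p = (\<Sum>i=1..I. \<Sum>j=1..J. ereal (z i j) * U i j (p i j))"

text \<open>
  The last clause is the convention \<open>p i j = 0\<close> for \<open>z i j = 0\<close>, together with the value \<open>0\<close>
  off the index range, which makes equality of allocations the equality of functions.
  It does not restrict the competitors \<open>q\<close>.
\<close>

definition power_allocation ::
  "nat \<Rightarrow> nat \<Rightarrow> (nat \<Rightarrow> nat \<Rightarrow> real) \<Rightarrow> real \<Rightarrow> real \<Rightarrow> (nat \<Rightarrow> nat \<Rightarrow> real \<Rightarrow> ereal) \<Rightarrow>
    (nat \<Rightarrow> nat \<Rightarrow> real) \<Rightarrow> (nat \<Rightarrow> nat \<Rightarrow> real) \<Rightarrow> bool"
where
  "power_allocation I J R W00 \<upsilon> U z p \<longleftrightarrow>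
     feasible I J R W00 \<upsilon> z p \<and>
     (\<forall>q. feasible I J R W00 \<upsilon> z q \<longrightarrow> total_utility I J U z q \<le> total_utility I J U z p) \<and>
     (\<forall>i j. i \<notin> {1..I} \<or> j \<notin> {1..J} \<or> z i j = 0 \<longrightarrow> p i j = 0)"

end

theory Submission
  imports Defs
begin

text \<open>
  Exchanging the order of summation, the constraint at the last node \<open>I\<close> reads
  \<open>\<Sum>\<^sub>i \<Sum>\<^sub>j a i j * p i j \<le> \<delta>\<close> with \<open>a i j = path_resistance R i * z i j\<close>, and it
  implies the other ones since voltages decrease along the line.  The objective is
  \<open>\<Sum>\<^sub>i \<Sum>\<^sub>j a i j * u (p i j)\<close> with the same weights, so strict Jensen forces all rates
  to agree with \<open>\<delta> / \<Sum>\<^sub>i \<Sum>\<^sub>j a i j\<close>.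
\<close>

section \<open>Supporting lines and a weighted Jensen inequality for utilities\<close>

lemma utility_finite:
  assumes "utility u" and "x > 0"
  shows "u x = ereal (real_of_ereal (u x))"
proof -
  have sm: "strict_mono_on {0..} u"
    using assms(1) by (simp add: utility_def)
  have "u 0 < u x" "u x < u (x + 1)"
    using assms(2) by (auto intro!: strict_mono_onD[OF sm])
  then show ?thesis
    by (cases "u x") auto
qed

lemma utility_midpoint:
  assumes "utility u" "x \<ge> 0" "y \<ge> 0" "x \<noteq> y"
  shows "ereal (1/2) * u x + ereal (1/2) * u y < u ((x + y) / 2)"
proof -
  have "ereal (1 - t) * u x + ereal t * u y < u ((1 - t) * x + t * y)" if "0 < t" "t < 1" for t
    using assms that by (simp add: utility_def strictly_concave_on_def)
  from this[of "1/2"] show ?thesis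
    by (simp add: add_divide_distrib)
qed

text \<open>The sign change and the passage to reals make the library's supporting line for convex
  functions available. The point 0 is left out because \<open>real_of_ereal\<close> would turn a
  possible \<open>-\<infinity>\<close> there into 0.\<close>

lemma utility_convex:
  assumes "utility u"
  shows "convex_on {0<..} (\<lambda>x. - real_of_ereal (u x))"
proof (rule convex_onI)
  fix t x y :: real
  assume t: "0 < t" "t < 1" and xy: "x \<in> {0<..}" "y \<in> {0<..}"
  let ?m = "(1 - t) * x + t * y"
  have pos: "?m > 0"
    using t xy by (simp add: add_pos_pos)
  show "- real_of_ereal (u ((1 - t) *\<^sub>R x + t *\<^sub>R y))
      \<le> (1 - t) * - real_of_ereal (u x) + t * - real_of_ereal (u y)"
  proof (cases "x = y")
    case True
    then show ?thesis by (simp add: algebra_simps)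
  next
    case False
    have "ereal (1 - t) * u x + ereal t * u y < u ?m"
      using assms False t xy unfolding utility_def strictly_concave_on_def by auto
    then have "ereal (1 - t) * ereal (real_of_ereal (u x)) + ereal t * ereal (real_of_ereal (u y))
        < ereal (real_of_ereal (u ?m))"
      using utility_finite[OF assms] pos xy by (metis greaterThan_iff)
    then show ?thesis by simp
  qed
qed simp

text \<open>
  Applying the supergradient inequality at the midpoint of \<open>c\<close> and \<open>x\<close>, which is positive,
  yields strictness and also covers \<open>x = 0\<close>, where \<open>u\<close> may be \<open>-\<infinity>\<close>.
\<close>

lemma utility_strict_tangent:
  assumes u: "utility u" and c: "c > 0"
  obtains s where "s > 0"
    and "\<And>x. x \<ge> 0 \<Longrightarrow> x \<noteq> c \<Longrightarrow> u x < ereal (real_of_ereal (u c) + s * (x - c))"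
proof -
  define v where "v x = real_of_ereal (u x)" for x
  have uv: "u x = ereal (v x)" if "x > 0" for x
    using utility_finite[OF u that] by (simp add: v_def)
  obtain s where s: "v x \<le> v c + s * (x - c)" if "x > 0" for x
  proof
    fix x :: real
    assume "x > 0"
    \<comment> \<open>The infimum of the secant slopes of \<open>- v\<close> to the right of
      \<open>c\<close> is its right derivative there; negated, it is a supergradient of
      \<open>v\<close> at \<open>c\<close>.\<close>
    then show "v x \<le> v c + (- Inf ((\<lambda>t. (- v c - - v t) / (c - t)) ` ({c<..} \<inter> {0<..}))) * (x - c)"
      using convex_le_Inf_differential[OF utility_convex[OF u], of c x] c
      by (simp add: v_def interior_open)
  qed
  have strict: "u x < ereal (v c + s * (x - c))" if "x \<ge> 0" "x \<noteq> c" for x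
  proof -
    \<comment> \<open>The midpoint is half as far from \<open>c\<close> as \<open>x\<close> is, so
      doubling the resulting inequality restores the slope \<open>s\<close>.\<close>
    have "ereal (1/2) * u x + ereal (1/2) * u c < u ((x + c) / 2)"
      using that c by (intro utility_midpoint u) auto
    also have "\<dots> \<le> ereal (v c + s * ((x + c) / 2 - c))"
      using s[of "(x + c) / 2"] that c by (simp add: uv)
    finally show ?thesis
      using c by (cases "u x") (auto simp: uv field_simps)
  qed
  have sm: "strict_mono_on {0..} u"
    using u by (simp add: utility_def)
  \<comment> \<open>Strict growth from \<open>c\<close> to \<open>c + 1\<close> is at most
    \<open>s\<close>, hence \<open>s > 0\<close>.\<close>
  have "u c < u (c + 1)"
    using c by (intro strict_mono_onD[OF sm]) auto
  then have "s > 0"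
    using s[of "c + 1"] c by (simp add: uv)
  then show thesis
    using strict by (intro that) (auto simp: v_def)
qed

text \<open>Weighting the tangent bounds at \<open>c\<close> by \<open>a\<close> and adding them
  leaves \<open>s\<close> times the excess over the budget. As \<open>s > 0\<close>, this term is
  nonpositive, so a budget inequality suffices in place of an equality of means.\<close>

lemma utility_jensen:
  fixes a q :: "'k \<Rightarrow> real"
  assumes u: "utility u" and c: "c > 0" and S: "finite S"
    and a: "\<And>k. k \<in> S \<Longrightarrow> a k \<ge> 0" and q: "\<And>k. k \<in> S \<Longrightarrow> q k \<ge> 0"
    and budget: "(\<Sum>k\<in>S. a k * q k) \<le> (\<Sum>k\<in>S. a k) * c"
  shows "(\<Sum>k\<in>S. ereal (a k) * u (q k)) \<le> (\<Sum>k\<in>S. ereal (a k) * u c)"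
    and "k0 \<in> S \<Longrightarrow> a k0 > 0 \<Longrightarrow> q k0 \<noteq> c \<Longrightarrow>
      (\<Sum>k\<in>S. ereal (a k) * u (q k)) < (\<Sum>k\<in>S. ereal (a k) * u c)"
proof -
  obtain s where s: "s > 0"
    and tangent: "\<And>x. x \<ge> 0 \<Longrightarrow> x \<noteq> c \<Longrightarrow> u x < ereal (real_of_ereal (u c) + s * (x - c))"
    using utility_strict_tangent[OF u c] by blast
  define b where "b k = a k * (real_of_ereal (u c) + s * (q k - c))" for k
  have uc: "u c = ereal (real_of_ereal (u c))"
    by (rule utility_finite[OF u c])
  have le: "ereal (a k) * u (q k) \<le> ereal (b k)" if "k \<in> S" for k
  proof -
    have "u (q k) \<le> ereal (real_of_ereal (u c) + s * (q k - c))"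
      using tangent[OF q[OF that]] uc by (cases "q k = c") auto
    from ereal_mult_left_mono[OF this, of "ereal (a k)"] a[OF that]
    show ?thesis by (simp add: b_def)
  qed
  have "sum b S = sum a S * real_of_ereal (u c) + s * ((\<Sum>k\<in>S. a k * q k) - sum a S * c)"
    by (simp add: b_def algebra_simps sum.distrib sum_subtractf sum_distrib_left sum_distrib_right)
  also have "\<dots> \<le> sum a S * real_of_ereal (u c)"
    using s budget by (simp add: mult_nonneg_nonpos)
  finally have "ereal (sum b S) \<le> ereal (sum a S * real_of_ereal (u c))"
    by simp
  also have "\<dots> = (\<Sum>k\<in>S. ereal (a k) * u c)"
    by (subst uc) (simp add: sum_distrib_right)
  finally have b: "ereal (sum b S) \<le> (\<Sum>k\<in>S. ereal (a k) * u c)" .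
  have "(\<Sum>k\<in>S. ereal (a k) * u (q k)) \<le> (\<Sum>k\<in>S. ereal (b k))"
    by (intro sum_mono le)
  with b show "(\<Sum>k\<in>S. ereal (a k) * u (q k)) \<le> (\<Sum>k\<in>S. ereal (a k) * u c)"
    by simp
  show "(\<Sum>k\<in>S. ereal (a k) * u (q k)) < (\<Sum>k\<in>S. ereal (a k) * u c)"
    if k0: "k0 \<in> S" "a k0 > 0" "q k0 \<noteq> c"
  proof -
    have lt: "ereal (a k0) * u (q k0) < ereal (b k0)"
      using tangent[OF q[OF k0(1)] k0(3)] k0(2)
      by (cases "u (q k0)") (auto simp: b_def)
    have "(\<Sum>k\<in>S. ereal (a k) * u (q k))
        = ereal (a k0) * u (q k0) + (\<Sum>k\<in>S - {k0}. ereal (a k) * u (q k))"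
      by (rule sum.remove[OF S k0(1)])
    \<comment> \<open>The other summands are replaced by reals first: with a tail equal to
      \<open>-\<infinity>\<close>, adding it would destroy strictness.\<close>
    also have "\<dots> \<le> ereal (a k0) * u (q k0) + (\<Sum>k\<in>S - {k0}. ereal (b k))"
      by (intro add_left_mono sum_mono le) auto
    also have "\<dots> < ereal (b k0) + (\<Sum>k\<in>S - {k0}. ereal (b k))"
      using lt by (cases "ereal (a k0) * u (q k0)") auto
    also have "\<dots> = ereal (sum b S)"
      by (simp add: sum.remove[OF S k0(1)])
    finally show ?thesis
      using b by simp
  qed
qed

section \<open>Voltage drops along the line\<close>

lemma path_resistance_pos:
  assumes "\<And>i. i \<in> {1..I} \<Longrightarrow> R (i - 1) i > 0" and "i \<in> {1..I}"
  shows "path_resistance R i > 0"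
  unfolding path_resistance_def using assms by (intro sum_pos) auto

text \<open>The load at node \<open>m\<close> passes exactly the edges \<open>l \<le> m\<close>,
  whose resistances add up to that of its path to the feeder.\<close>

lemma voltage_drop_path_resistance:
  "(\<Sum>l=1..I. R (l - 1) l * (\<Sum>m=l..I. y m)) = (\<Sum>m=1..I. path_resistance R m * y m)"
proof -
  have "(\<Sum>l=1..I. R (l - 1) l * (\<Sum>m=l..I. y m))
      = (\<Sum>l\<in>{1..I}. \<Sum>m | m \<in> {1..I} \<and> l \<le> m. R (l - 1) l * y m)"
    unfolding sum_distrib_left by (intro sum.cong) auto
  also have "\<dots> = (\<Sum>m\<in>{1..I}. \<Sum>l | l \<in> {1..I} \<and> l \<le> m. R (l - 1) l * y m)"
    by (rule sum.swap_restrict) auto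
  also have "\<dots> = (\<Sum>m=1..I. path_resistance R m * y m)"
    unfolding path_resistance_def sum_distrib_right by (intro sum.cong) auto
  finally show ?thesis .
qed

text \<open>With nonnegative rates every edge contributes a nonnegative drop, so the lowest voltage
  is at node \<open>I\<close>; \<open>I \<ge> 1\<close> ensures that this node is among the
  constrained ones.\<close>

lemma feasible_iff_budget:
  assumes R: "\<And>i. i \<in> {1..I} \<Longrightarrow> R (i - 1) i > 0"
    and z: "\<And>i j. i \<in> {1..I} \<Longrightarrow> j \<in> {1..J} \<Longrightarrow> z i j \<ge> 0"
    and I: "I \<ge> 1"
  shows "feasible I J R W00 \<upsilon> z q \<longleftrightarrow>
    (\<forall>i\<in>{1..I}. \<forall>j\<in>{1..J}. q i j \<ge> 0) \<and>
    (\<Sum>i=1..I. path_resistance R i * (\<Sum>j=1..J. z i j * q i j)) \<le> (W00 - \<upsilon>) / 2"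
proof (cases "\<forall>i\<in>{1..I}. \<forall>j\<in>{1..J}. q i j \<ge> 0")
  case True
  have drop: "W_lin I J R W00 z q k \<ge> W_lin I J R W00 z q I" if "k \<in> {1..I}" for k
    unfolding W_lin_def using that True z R
    by (intro diff_left_mono mult_left_mono sum_mono2)
      (auto intro!: mult_nonneg_nonneg sum_nonneg less_imp_le[of 0 "R _ _"])
  have last: "W_lin I J R W00 z q I
      = W00 - 2 * (\<Sum>i=1..I. path_resistance R i * (\<Sum>j=1..J. z i j * q i j))"
    unfolding W_lin_def voltage_drop_path_resistance ..
  have "feasible I J R W00 \<upsilon> z q \<longleftrightarrow> W_lin I J R W00 z q I \<ge> \<upsilon>"
    unfolding feasible_def using True drop I order_trans by fastforce
  with True show ?thesis
    unfolding last by auto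
qed (auto simp: feasible_def)

section \<open>The optimal allocation\<close>

theorem proposition4:
  fixes I J :: nat
    and R :: "nat \<Rightarrow> nat \<Rightarrow> real"
    and W00 \<upsilon> \<delta> :: real
    and u :: "real \<Rightarrow> ereal"
    and w :: "nat \<Rightarrow> nat \<Rightarrow> real"
    and U :: "nat \<Rightarrow> nat \<Rightarrow> real \<Rightarrow> ereal"
    and z :: "nat \<Rightarrow> nat \<Rightarrow> real"
  assumes "\<And>i. i \<in> {1..I} \<Longrightarrow> R (i - 1) i > 0"
    and "0 < \<upsilon>" and "\<upsilon> < W00"
    and "\<delta> = (W00 - \<upsilon>) / 2"
    and "utility u"
    and "\<And>i j x. i \<in> {1..I} \<Longrightarrow> j \<in> {1..J} \<Longrightarrow> x \<ge> 0 \<Longrightarrow> U i j x = ereal (w i j) * u x"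
    and "\<And>i j. i \<in> {1..I} \<Longrightarrow> j \<in> {1..J} \<Longrightarrow> w i j = path_resistance R i"
    and "\<And>i j. i \<in> {1..I} \<Longrightarrow> j \<in> {1..J} \<Longrightarrow> z i j \<ge> 0"
    and "\<exists>i\<in>{1..I}. \<exists>j\<in>{1..J}. z i j \<noteq> 0"
  shows "(\<exists>!p. power_allocation I J R W00 \<upsilon> U z p) \<and>
    (\<forall>p. power_allocation I J R W00 \<upsilon> U z p \<longrightarrow>
      (\<exists>c>0. c = \<delta> * inverse (\<Sum>i=1..I. path_resistance R i * (\<Sum>j=1..J. z i j)) \<and>
        (\<forall>i\<in>{1..I}. \<forall>j\<in>{1..J}. z i j > 0 \<longrightarrow> p i j = c)))"
proof -
  define A where "A = (\<Sum>i=1..I. path_resistance R i * (\<Sum>j=1..J. z i j))"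
  \<comment> \<open>The common rate that exhausts the budget:
    \<open>A * c = \<delta>\<close>.\<close>
  define c where "c = \<delta> * inverse A"
  define S where "S = {1..I} \<times> {1..J}"
  define a where "a = (\<lambda>(i, j). path_resistance R i * z i j)"
  define p0 where "p0 i j = (if i \<in> {1..I} \<and> j \<in> {1..J} \<and> z i j \<noteq> 0 then c else 0)" for i j
  have fin: "finite S"
    by (simp add: S_def)
  have a_nonneg: "a k \<ge> 0" if "k \<in> S" for k
    using that path_resistance_pos[of I R, OF assms(1)] assms(8)
    by (auto simp: S_def a_def less_imp_le)
  have a_pos: "a (i, j) > 0" if "i \<in> {1..I}" "j \<in> {1..J}" "z i j \<noteq> 0" for i j
    using that path_resistance_pos[of I R, OF assms(1) that(1)] assms(8)[OF that(1,2)]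
    by (auto simp: a_def)
  have A: "A = sum a S"
    by (simp add: A_def S_def a_def sum_distrib_left sum.cartesian_product)
  obtain i0 j0 where ij0: "i0 \<in> {1..I}" "j0 \<in> {1..J}" "z i0 j0 \<noteq> 0"
    using assms(9) by blast
  have "A > 0"
    unfolding A using a_pos[OF ij0] ij0 a_nonneg by (intro sum_pos2[OF fin]) (auto simp: S_def)
  then have c_pos: "c > 0" and Ac: "A * c = \<delta>"
    using assms(3,4) by (auto simp: c_def)
  have feasible: "feasible I J R W00 \<upsilon> z q \<longleftrightarrow>
      (\<forall>k\<in>S. case_prod q k \<ge> 0) \<and> (\<Sum>k\<in>S. a k * case_prod q k) \<le> sum a S * c" for q
  proof -
    have "(\<Sum>i=1..I. path_resistance R i * (\<Sum>j=1..J. z i j * q i j)) = (\<Sum>k\<in>S. a k * case_prod q k)"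
      by (simp add: S_def a_def sum_distrib_left sum.cartesian_product split_def mult.assoc)
    moreover have "(W00 - \<upsilon>) / 2 = sum a S * c"
      using Ac A assms(4) by simp
    moreover have "feasible I J R W00 \<upsilon> z q \<longleftrightarrow>
        (\<forall>i\<in>{1..I}. \<forall>j\<in>{1..J}. q i j \<ge> 0) \<and>
        (\<Sum>i=1..I. path_resistance R i * (\<Sum>j=1..J. z i j * q i j)) \<le> (W00 - \<upsilon>) / 2"
      using assms(1,8) ij0 by (intro feasible_iff_budget) auto
    ultimately show ?thesis
      unfolding S_def by simp
  qed
  \<comment> \<open>The choice of \<open>w\<close> makes the objective weights equal to the budget
    weights \<open>a\<close>. Nonnegativity is assumed because \<open>U i j\<close> is prescribed
    only on nonnegative arguments.\<close>
  have utility: "total_utility I J U z q = (\<Sum>k\<in>S. ereal (a k) * u (case_prod q k))"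
    if "\<forall>k\<in>S. case_prod q k \<ge> 0" for q
  proof -
    have "total_utility I J U z q = (\<Sum>i=1..I. \<Sum>j=1..J. ereal (a (i, j)) * u (q i j))"
      unfolding total_utility_def
    proof (intro sum.cong refl)
      fix i j
      assume ij: "i \<in> {1..I}" "j \<in> {1..J}"
      with that have "q i j \<ge> 0"
        by (auto simp: S_def)
      with ij show "ereal (z i j) * U i j (q i j) = ereal (a (i, j)) * u (q i j)"
        by (simp add: assms(6,7) a_def mult.assoc[symmetric] mult.commute)
    qed
    then show ?thesis
      by (simp add: S_def sum.cartesian_product split_def)
  qed
  \<comment> \<open>Where \<open>z i j = 0\<close>, the rate of \<open>p0\<close> is 0 rather than
    \<open>c\<close>, but the weight vanishes too, and \<open>0 * u 0 = 0\<close> in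
    \<open>ereal\<close> even if \<open>u 0 = -\<infinity>\<close>.\<close>
  have a_p0: "a k * case_prod p0 k = a k * c"
    and u_p0: "ereal (a k) * u (case_prod p0 k) = ereal (a k) * u c" if "k \<in> S" for k
    using that by (auto simp: S_def p0_def a_def zero_ereal_def[symmetric])
  have p0_nonneg: "\<forall>k\<in>S. case_prod p0 k \<ge> 0"
    using c_pos by (auto simp: p0_def)
  have "(\<Sum>k\<in>S. a k * case_prod p0 k) = sum a S * c"
    by (simp add: a_p0 sum_distrib_right)
  with p0_nonneg have p0_feasible: "feasible I J R W00 \<upsilon> z p0"
    by (simp add: feasible)
  have p0_value: "total_utility I J U z p0 = (\<Sum>k\<in>S. ereal (a k) * u c)"
    unfolding utility[OF p0_nonneg] by (intro sum.cong refl u_p0)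
  have p0_alloc: "power_allocation I J R W00 \<upsilon> U z p0"
    unfolding power_allocation_def
  proof (intro conjI allI impI)
    fix q
    assume "feasible I J R W00 \<upsilon> z q"
    then have "\<forall>k\<in>S. case_prod q k \<ge> 0" "(\<Sum>k\<in>S. a k * case_prod q k) \<le> sum a S * c"
      by (simp_all add: feasible)
    then show "total_utility I J U z q \<le> total_utility I J U z p0"
      using utility_jensen(1)[OF assms(5) c_pos fin a_nonneg, where q = "case_prod q"]
      by (simp add: utility p0_value)
  qed (use p0_feasible in \<open>auto simp: p0_def\<close>)
  \<comment> \<open>At an entry of positive weight, a rate other than \<open>c\<close> would make
    \<open>p\<close> strictly worse than the feasible \<open>p0\<close>; all remaining entries are 0
    by convention.\<close>
  have unique: "p = p0" if p: "power_allocation I J R W00 \<upsilon> U z p" for p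
  proof (intro ext)
    fix i j
    have pf: "\<forall>k\<in>S. case_prod p k \<ge> 0" "(\<Sum>k\<in>S. a k * case_prod p k) \<le> sum a S * c"
      using p by (simp_all add: power_allocation_def feasible)
    have best: "total_utility I J U z p0 \<le> total_utility I J U z p"
      using p p0_feasible by (simp add: power_allocation_def)
    show "p i j = p0 i j"
    proof (cases "i \<in> {1..I} \<and> j \<in> {1..J} \<and> z i j \<noteq> 0")
      case True
      have "p i j = c"
      proof (rule ccontr)
        assume "p i j \<noteq> c"
        then have "total_utility I J U z p < total_utility I J U z p0"
          using utility_jensen(2)[OF assms(5) c_pos fin a_nonneg, where q = "case_prod p" and ?k0.0 = "(i, j)"]
            True pf a_pos[of i j]
          by (simp add: utility p0_value S_def)
        with best show False by simp
      qed
      with True show ?thesis by (simp add: p0_def)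
    next
      case False
      then show ?thesis
        using p by (auto simp: power_allocation_def p0_def)
    qed
  qed
  have p0_const: "p0 i j = c" if "i \<in> {1..I}" "j \<in> {1..J}" "z i j > 0" for i j
    using that by (simp add: p0_def)
  show ?thesis
  proof (intro conjI allI impI)
    show "\<exists>!p. power_allocation I J R W00 \<upsilon> U z p"
      using p0_alloc unique by blast
  next
    fix p
    assume "power_allocation I J R W00 \<upsilon> U z p"
    then have "p = p0"
      by (rule unique)
    then show "\<exists>c>0. c = \<delta> * inverse (\<Sum>i=1..I. path_resistance R i * (\<Sum>j=1..J. z i j)) \<and>
        (\<forall>i\<in>{1..I}. \<forall>j\<in>{1..J}. z i j > 0 \<longrightarrow> p i j = c)"
      using c_pos p0_const
      by (intro exI[of _ c] conjI ballI impI) (simp_all only: c_def A_def)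
  qed
qed

end
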